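(* Let $R$ be a finite commutative ring with identity, written as a direct sum of local rings $R = R_1\oplus\cdots\oplus R_n$, where $R_i$ has unique maximal ideal $M_i$, unit group $R_i^*$, and $q_i=|R_i/M_i|$. For $k\ge1$ let $\prod_{i=1}^k R^{**}=\{x_1\cdots x_k : x_1,\ldots,x_k\in R^{**}\}$. (i) If $q_i>3$ for each $i$, then $R^{**}\cdot R^{**}=R^*$. (ii) If $q_1=\cdots=q_s=3$ for some $s\ge1$ and $q_j>3$ for each $j>s$, then for any integer $k\ge2$, $\prod_{i=1}^k R^{**}$ is the set of $(u_1,\ldots,u_n)$ with $u_j\in R_j^*$ arbitrary for $j>s$ and, for all $i\le s$: $u_i\in 1+M_i$ if $k$ is even; $u_i\in R_i^*\setminus(1+M_i)$ if $k$ is odd. In particular, every unit of $R$ is a product of exceptional units of $R$ if and only if $s=1$.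
   Context: A unit $u$ of a commutative ring $R$ with identity is called exceptional if $1-u$ is also a unit; $R^{**}$ denotes the set of exceptional units and $R^*$ the unit group. Every finite commutative ring with identity is uniquely a direct sum of finite local rings; elements are written as tuples. *)

theory Defs
  imports "HOL-Algebra.Algebra"
begin

definition local_ring :: "('a, 'm) ring_scheme \<Rightarrow> bool" where
  "local_ring R \<longleftrightarrow> cring R \<and> (\<exists>!M. maximalideal M R)"

definition exceptional_units :: "('a, 'm) ring_scheme \<Rightarrow> 'a set" where
  "exceptional_units R = {u \<in> Units R. \<one>\<^bsub>R\<^esub> \<ominus>\<^bsub>R\<^esub> u \<in> Units R}"

definition exceptional_products :: "('a, 'm) ring_scheme \<Rightarrow> nat \<Rightarrow> 'a set" where
  "exceptional_products R k =
     {\<Otimes>\<^bsub>R\<^esub>i\<in>{1..k}. x i | x. x \<in> {1..k} \<rightarrow> exceptional_units R}"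

end

theory Submission
  imports Defs
begin

text \<open>
  Membership in a product of exceptional units can be tested in each local factor. There, an
  element is a unit iff its residue is nonzero, and exceptional iff its residue is neither
  \<open>0\<close> nor \<open>1\<close>. Over a residue field with more than three elements, every unit \<open>u\<close> is
  \<open>x (x\<^sup>-\<^sup>1 u)\<close> with \<open>x\<close> outside the residue classes of \<open>0\<close>, \<open>1\<close>, \<open>u\<close>. Over the field with three
  elements, exceptional units are those of residue \<open>-1\<close>, so the residue of a \<open>k\<close>-fold product
  is \<open>(-1)\<^sup>k\<close>; the parity of \<open>k\<close> is the same in all factors, which obstructs
  units of residues \<open>1\<close> and \<open>-1\<close> in two such factors.
\<close>

section \<open>Products of exceptional units\<close>

context cring
begin

text \<open>The witness \<open>v\<close> can only be \<open>\<one> \<ominus> u\<close>. The equation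
  \<open>v \<oplus> u = \<one>\<close> avoids subtraction, so homomorphism laws and componentwise
  formulas treat it exactly like the inverse equation of a unit.\<close>

lemma exceptional_units_iff:
  "u \<in> exceptional_units R \<longleftrightarrow> u \<in> Units R \<and> (\<exists>v\<in>Units R. v \<oplus> u = \<one>)"
proof
  assume "u \<in> exceptional_units R"
  then have "u \<in> Units R" "\<one> \<ominus> u \<in> Units R"
    by (auto simp: exceptional_units_def)
  moreover have "(\<one> \<ominus> u) \<oplus> u = \<one>"
    using \<open>u \<in> Units R\<close> Units_closed[of u] by (simp add: a_minus_def add.m_assoc l_neg)
  ultimately show "u \<in> Units R \<and> (\<exists>v\<in>Units R. v \<oplus> u = \<one>)"
    by blast
next
  assume "u \<in> Units R \<and> (\<exists>v\<in>Units R. v \<oplus> u = \<one>)"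
  then obtain v where v: "u \<in> Units R" "v \<in> Units R" "v \<oplus> u = \<one>"
    by blast
  then have "u \<in> carrier R" "v \<in> carrier R"
    by auto
  then have "v = \<one> \<ominus> u"
    unfolding v(3)[symmetric] by (simp add: a_minus_def add.m_assoc r_neg)
  with v show "u \<in> exceptional_units R"
    by (simp add: exceptional_units_def)
qed

lemma exceptional_units_subset: "exceptional_units R \<subseteq> carrier R"
  by (auto simp: exceptional_units_def)

lemma exceptional_products_0: "exceptional_products R 0 = {\<one>}"
  by (auto simp: exceptional_products_def)

text \<open>Splitting off the last factor turns indexed products into iterated set products; the
  later inductions on \<open>k\<close> rest on this recursion.\<close>

lemma exceptional_products_Suc:
  "exceptional_products R (Suc k) = exceptional_products R k <#> exceptional_units R"
proof -
  have ins: "{1..Suc k} = insert (Suc k) {1..k}"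
    by auto
  have step: "finprod R x {1..Suc k} = finprod R x {1..k} \<otimes> x (Suc k)"
    if "x \<in> {1..Suc k} \<rightarrow> exceptional_units R" for x
  proof -
    have "x \<in> {1..k} \<rightarrow> carrier R" "x (Suc k) \<in> carrier R"
      using that exceptional_units_subset by fastforce+
    then show ?thesis
      unfolding ins by (subst finprod_insert) (auto simp: m_comm)
  qed
  show ?thesis
  proof (intro subset_antisym subsetI)
    fix p
    assume "p \<in> exceptional_products R (Suc k)"
    then obtain x where x: "x \<in> {1..Suc k} \<rightarrow> exceptional_units R" "p = finprod R x {1..Suc k}"
      by (auto simp: exceptional_products_def)
    have "finprod R x {1..k} \<in> exceptional_products R k"
      using x(1) unfolding exceptional_products_def by fastforce
    moreover have "x (Suc k) \<in> exceptional_units R"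
      using x(1) by auto
    ultimately show "p \<in> exceptional_products R k <#> exceptional_units R"
      unfolding x(2) step[OF x(1)] by (auto simp: set_mult_def)
  next
    fix p
    assume "p \<in> exceptional_products R k <#> exceptional_units R"
    then obtain x e where x: "x \<in> {1..k} \<rightarrow> exceptional_units R"
      and e: "e \<in> exceptional_units R" and p: "p = finprod R x {1..k} \<otimes> e"
      by (auto simp: exceptional_products_def set_mult_def)
    \<comment> \<open>The function \<open>x\<close> is constrained only on \<open>{1..k}\<close>, so
      overwriting its value at \<open>Suc k\<close> keeps the first \<open>k\<close>
      factors.\<close>
    let ?y = "x(Suc k := e)"
    have y: "?y \<in> {1..Suc k} \<rightarrow> exceptional_units R"
      using x e by (auto simp: Pi_iff)
    have "finprod R ?y {1..k} = finprod R x {1..k}"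
      using x exceptional_units_subset by (intro finprod_cong') (auto simp: Pi_iff)
    then have "p = finprod R ?y {1..Suc k}"
      unfolding p step[OF y] by simp
    then show "p \<in> exceptional_products R (Suc k)"
      using y unfolding exceptional_products_def by blast
  qed
qed

lemma exceptional_products_subset: "exceptional_products R k \<subseteq> carrier R"
proof (induction k)
  case 0
  then show ?case by (simp add: exceptional_products_0)
next
  case (Suc k)
  then show ?case
    by (simp add: exceptional_products_Suc exceptional_units_subset set_mult_closed)
qed

lemma exceptional_products_1: "exceptional_products R 1 = exceptional_units R"
  using exceptional_units_subset
  by (force simp: exceptional_products_Suc exceptional_products_0 set_mult_def)

lemma exceptional_products_2:
  "exceptional_products R 2 = exceptional_units R <#> exceptional_units R"
  using exceptional_products_Suc[of 1] unfolding exceptional_products_1 by (simp add: numeral_2_eq_2)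

end

section \<open>Transport along isomorphisms and direct products\<close>

lemma ring_iso_Units:
  assumes "cring R" "cring S" "f \<in> ring_iso R S" "u \<in> carrier R"
  shows "f u \<in> Units S \<longleftrightarrow> u \<in> Units R"
proof -
  interpret R: cring R by fact
  interpret S: cring S by fact
  note f = ring_iso_memE[OF assms(3)]
  have inj: "inj_on f (carrier R)" and surj: "f ` carrier R = carrier S"
    using f(5) by (auto simp: bij_betw_def)
  \<comment> \<open>Writing \<open>carrier S\<close> as an image moves the search for an inverse
    from \<open>S\<close> to \<open>R\<close>; injectivity reflects the equation back.\<close>
  have "(\<exists>w\<in>carrier S. w \<otimes>\<^bsub>S\<^esub> f u = \<one>\<^bsub>S\<^esub>) \<longleftrightarrow> (\<exists>v\<in>carrier R. v \<otimes>\<^bsub>R\<^esub> u = \<one>\<^bsub>R\<^esub>)"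
    unfolding surj[symmetric] bex_simps
    using assms(4) by (auto simp: f(2,4)[symmetric] inj_on_eq_iff[OF inj])
  then show ?thesis
    using assms(4) f(1) by (auto simp: Units_def R.m_comm S.m_comm)
qed

lemma ring_iso_exceptional_units:
  assumes "cring R" "cring S" "f \<in> ring_iso R S" "u \<in> carrier R"
  shows "f u \<in> exceptional_units S \<longleftrightarrow> u \<in> exceptional_units R"
proof -
  interpret R: cring R by fact
  interpret S: cring S by fact
  note f = ring_iso_memE[OF assms(3)]
  have inj: "inj_on f (carrier R)" and surj: "f ` carrier R = carrier S"
    using f(5) by (auto simp: bij_betw_def)
  have "Units S = f ` Units R"
  proof (intro subset_antisym subsetI)
    fix w
    assume w: "w \<in> Units S"
    then obtain v where "v \<in> carrier R" "w = f v"
      using surj S.Units_closed[OF w] by auto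
    then show "w \<in> f ` Units R"
      using w ring_iso_Units[OF assms(1-3)] by simp
  qed (use ring_iso_Units[OF assms(1-3)] R.Units_closed in auto)
  then have "(\<exists>w\<in>Units S. w \<oplus>\<^bsub>S\<^esub> f u = \<one>\<^bsub>S\<^esub>) \<longleftrightarrow> (\<exists>v\<in>Units R. v \<oplus>\<^bsub>R\<^esub> u = \<one>\<^bsub>R\<^esub>)"
    using assms(4) by (auto simp: f(3,4)[symmetric] inj_on_eq_iff[OF inj] R.Units_closed)
  then show ?thesis
    using ring_iso_Units[OF assms]
    by (simp add: R.exceptional_units_iff S.exceptional_units_iff)
qed

lemma ring_iso_image_exceptional_products:
  assumes "cring R" "cring S" "f \<in> ring_iso R S"
  shows "f ` exceptional_products R k = exceptional_products S k"
proof (induction k)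
  case 0
  show ?case
    using assms ring_iso_memE(4)[OF assms(3)] by (simp add: cring.exceptional_products_0)
next
  case (Suc k)
  interpret R: cring R by fact
  interpret S: cring S by fact
  note f = ring_iso_memE[OF assms(3)]
  have surj: "f ` carrier R = carrier S"
    using f(5) by (auto simp: bij_betw_def)
  have E: "f ` exceptional_units R = exceptional_units S"
  proof (intro subset_antisym subsetI)
    fix w
    assume w: "w \<in> exceptional_units S"
    then obtain v where "v \<in> carrier R" "w = f v"
      using surj subsetD[OF S.exceptional_units_subset w] by auto
    then show "w \<in> f ` exceptional_units R"
      using w ring_iso_exceptional_units[OF assms] by simp
  qed (use ring_iso_exceptional_units[OF assms] R.exceptional_units_subset in auto)
  have mult: "f ` (A <#>\<^bsub>R\<^esub> B) = f ` A <#>\<^bsub>S\<^esub> f ` B"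
    if "A \<subseteq> carrier R" "B \<subseteq> carrier R" for A B
  proof -
    have "f (a \<otimes>\<^bsub>R\<^esub> b) = f a \<otimes>\<^bsub>S\<^esub> f b" if "a \<in> A" "b \<in> B" for a b
      using that \<open>A \<subseteq> carrier R\<close> \<open>B \<subseteq> carrier R\<close> f(2) by blast
    then show ?thesis
      by (auto simp: set_mult_def image_UN)
  qed
  show ?case
    by (simp add: R.exceptional_products_Suc S.exceptional_products_Suc mult
        R.exceptional_products_subset R.exceptional_units_subset Suc E)
qed

section \<open>Componentwise computation in a finite direct product\<close>

lemma RDirProd_list_Cons_simps:
  assumes "as \<in> carrier (RDirProd_list Rs)" "bs \<in> carrier (RDirProd_list Rs)"
    "a \<in> carrier R" "b \<in> carrier R"
  shows "(a # as) \<otimes>\<^bsub>RDirProd_list (R # Rs)\<^esub> (b # bs) = (a \<otimes>\<^bsub>R\<^esub> b) # (as \<otimes>\<^bsub>RDirProd_list Rs\<^esub> bs)"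
    and "(a # as) \<oplus>\<^bsub>RDirProd_list (R # Rs)\<^esub> (b # bs) = (a \<oplus>\<^bsub>R\<^esub> b) # (as \<oplus>\<^bsub>RDirProd_list Rs\<^esub> bs)"
  \<comment> \<open>Consing is an isomorphism from the binary product of \<open>R\<close> with
    \<open>RDirProd_list Rs\<close>; its homomorphism laws are the two formulas.\<close>
  using ring_iso_memE(2,3)[OF RDirProd_list_iso1, of "(a, as)" R Rs "(b, bs)"] assms
  by (simp_all add: RDirProd_def DirProd_def monoid.defs)

lemma RDirProd_list_nth_mult_add:
  assumes "as \<in> carrier (RDirProd_list Rs)" "bs \<in> carrier (RDirProd_list Rs)" "i < length Rs"
  shows "(as \<otimes>\<^bsub>RDirProd_list Rs\<^esub> bs) ! i = as ! i \<otimes>\<^bsub>Rs ! i\<^esub> bs ! i \<and>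
    (as \<oplus>\<^bsub>RDirProd_list Rs\<^esub> bs) ! i = as ! i \<oplus>\<^bsub>Rs ! i\<^esub> bs ! i"
  using assms
proof (induction Rs arbitrary: as bs i)
  case Nil
  then show ?case by simp
next
  case (Cons R Rs)
  then obtain a as' b bs' where "as = a # as'" "bs = b # bs'"
    "as' \<in> carrier (RDirProd_list Rs)" "bs' \<in> carrier (RDirProd_list Rs)"
    "a \<in> carrier R" "b \<in> carrier R"
    by (auto simp: RDirProd_list_carrier)
  with Cons.IH[of as' bs' "i - 1"] Cons.prems(3) show ?case
    by (cases i) (simp_all add: RDirProd_list_Cons_simps)
qed

lemma RDirProd_list_nth_one:
  "i < length Rs \<Longrightarrow> \<one>\<^bsub>RDirProd_list Rs\<^esub> ! i = \<one>\<^bsub>Rs ! i\<^esub>"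
  unfolding RDirProd_list_one by (induction Rs arbitrary: i) (auto simp: nth_Cons split: nat.split)

locale cring_list =
  fixes Rs :: "('a, 'm) ring_scheme list"
  assumes cring_nth: "i < length Rs \<Longrightarrow> cring (Rs ! i)"
begin

abbreviation "P \<equiv> RDirProd_list Rs"

lemma carrier_iff: "u \<in> carrier P \<longleftrightarrow> length u = length Rs \<and> (\<forall>i<length Rs. u ! i \<in> carrier (Rs ! i))"
  using RDirProd_list_carrier_mem[of u Rs] RDirProd_list_carrier_memI[of u Rs] by blast

lemma ring_P: "ring P"
  using cring_nth by (intro RDirProd_list_is_ring) (simp add: cring.axioms)

lemma eq_iff:
  assumes "u \<in> carrier P" "v \<in> carrier P"
  shows "u = v \<longleftrightarrow> (\<forall>i<length Rs. u ! i = v ! i)"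
  using assms by (auto simp: carrier_iff list_eq_iff_nth_eq)

lemma cring_P: "cring P"
proof -
  interpret P: ring P by (rule ring_P)
  show ?thesis
  proof (unfold_locales)
    fix u v
    assume uv: "u \<in> carrier P" "v \<in> carrier P"
    have "u ! i \<otimes>\<^bsub>Rs ! i\<^esub> v ! i = v ! i \<otimes>\<^bsub>Rs ! i\<^esub> u ! i" if "i < length Rs" for i
    proof -
      interpret Ri: cring "Rs ! i" by (rule cring_nth[OF that])
      show ?thesis
        using uv that by (intro Ri.m_comm) (auto simp: carrier_iff)
    qed
    then show "u \<otimes>\<^bsub>P\<^esub> v = v \<otimes>\<^bsub>P\<^esub> u"
      using uv by (simp add: eq_iff RDirProd_list_nth_mult_add)
  qed
qed

sublocale P: cring P
  by (rule cring_P)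

lemma eq_one_iff:
  assumes "u \<in> carrier P" "v \<in> carrier P"
  shows "u \<otimes>\<^bsub>P\<^esub> v = \<one>\<^bsub>P\<^esub> \<longleftrightarrow> (\<forall>i<length Rs. u ! i \<otimes>\<^bsub>Rs ! i\<^esub> v ! i = \<one>\<^bsub>Rs ! i\<^esub>)"
    and "u \<oplus>\<^bsub>P\<^esub> v = \<one>\<^bsub>P\<^esub> \<longleftrightarrow> (\<forall>i<length Rs. u ! i \<oplus>\<^bsub>Rs ! i\<^esub> v ! i = \<one>\<^bsub>Rs ! i\<^esub>)"
  using assms by (simp_all add: eq_iff RDirProd_list_nth_mult_add RDirProd_list_nth_one)

text \<open>Choice over finitely many indices: witnesses found independently in each position are
  collected into one list. This is what reduces existence statements about the product to its
  factors.\<close>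

lemma ex_list_iff:
  "(\<exists>u. length u = n \<and> (\<forall>i<n. Q i (u ! i))) \<longleftrightarrow> (\<forall>i<n. \<exists>x. Q i x)"
  using Skolem_list_nth[of n Q] by auto

lemma ex_carrier_iff:
  assumes "\<And>i x. Q i x \<Longrightarrow> i < length Rs \<Longrightarrow> x \<in> carrier (Rs ! i)"
  shows "(\<exists>u\<in>carrier P. \<forall>i<length Rs. Q i (u ! i)) \<longleftrightarrow> (\<forall>i<length Rs. \<exists>x. Q i x)"
  unfolding ex_list_iff[symmetric] Bex_def carrier_iff using assms by blast

text \<open>By commutativity a unit amounts to solvability of the single equation
  \<open>v \<otimes> u = \<one>\<close>, which splits into independent equations in the
  factors.\<close>

lemma Units_iff:
  "u \<in> Units P \<longleftrightarrow> length u = length Rs \<and> (\<forall>i<length Rs. u ! i \<in> Units (Rs ! i))"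
proof -
  have comm: "x \<in> Units (Rs ! i) \<longleftrightarrow>
      x \<in> carrier (Rs ! i) \<and> (\<exists>y. y \<in> carrier (Rs ! i) \<and> y \<otimes>\<^bsub>Rs ! i\<^esub> x = \<one>\<^bsub>Rs ! i\<^esub>)"
    if "i < length Rs" for i x
  proof -
    interpret Ri: cring "Rs ! i" by (rule cring_nth[OF that])
    show ?thesis
      by (auto simp: Units_def Ri.m_comm)
  qed
  show ?thesis
  proof (cases "u \<in> carrier P")
    case True
    then have "u \<in> Units P \<longleftrightarrow> (\<exists>v\<in>carrier P. v \<otimes>\<^bsub>P\<^esub> u = \<one>\<^bsub>P\<^esub>)"
      by (auto simp: Units_def P.m_comm)
    also have "\<dots> \<longleftrightarrow> (\<exists>v\<in>carrier P. \<forall>i<length Rs. v ! i \<in> carrier (Rs ! i) \<and>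
        v ! i \<otimes>\<^bsub>Rs ! i\<^esub> u ! i = \<one>\<^bsub>Rs ! i\<^esub>)"
      using True by (intro bex_cong refl) (auto simp: eq_one_iff carrier_iff)
    also have "\<dots> \<longleftrightarrow> (\<forall>i<length Rs. \<exists>y. y \<in> carrier (Rs ! i) \<and> y \<otimes>\<^bsub>Rs ! i\<^esub> u ! i = \<one>\<^bsub>Rs ! i\<^esub>)"
      by (rule ex_carrier_iff) blast
    also have "\<dots> \<longleftrightarrow> (\<forall>i<length Rs. u ! i \<in> Units (Rs ! i))"
      using True by (simp add: comm carrier_iff)
    finally show ?thesis
      using True by (simp add: carrier_iff)
  next
    case False
    then show ?thesis
      using P.Units_closed[of u] comm carrier_iff[of u] by blast
  qed
qed

lemma exceptional_units_iff:
  "u \<in> exceptional_units P \<longleftrightarrow>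
    length u = length Rs \<and> (\<forall>i<length Rs. u ! i \<in> exceptional_units (Rs ! i))"
proof -
  have comp: "x \<in> exceptional_units (Rs ! i) \<longleftrightarrow>
      x \<in> Units (Rs ! i) \<and> (\<exists>y. y \<in> Units (Rs ! i) \<and> y \<oplus>\<^bsub>Rs ! i\<^esub> x = \<one>\<^bsub>Rs ! i\<^esub>)"
    if "i < length Rs" for i x
    using cring.exceptional_units_iff[OF cring_nth[OF that]] by blast
  have cl: "x \<in> carrier (Rs ! i)" if "x \<in> Units (Rs ! i)" for x i
    using that by (simp add: Units_def)
  show ?thesis
  proof (cases "u \<in> carrier P")
    case True
    \<comment> \<open>The witness ranges over units rather than over the carrier, so its unit
      condition is first made componentwise; then \<open>ex_carrier_iff\<close> applies.\<close>
    have "v \<in> Units P \<and> v \<oplus>\<^bsub>P\<^esub> u = \<one>\<^bsub>P\<^esub> \<longleftrightarrow>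
        v \<in> carrier P \<and> (\<forall>i<length Rs. v ! i \<in> Units (Rs ! i) \<and>
          v ! i \<oplus>\<^bsub>Rs ! i\<^esub> u ! i = \<one>\<^bsub>Rs ! i\<^esub>)" for v
    proof (cases "v \<in> carrier P")
      case v: True
      then have "length v = length Rs"
        by (simp add: carrier_iff)
      then show ?thesis
        using v True by (auto simp: Units_iff eq_one_iff)
    next
      case False
      then show ?thesis
        using P.Units_closed[of v] by blast
    qed
    then have "(\<exists>v\<in>Units P. v \<oplus>\<^bsub>P\<^esub> u = \<one>\<^bsub>P\<^esub>) \<longleftrightarrow>
        (\<exists>v\<in>carrier P. \<forall>i<length Rs. v ! i \<in> Units (Rs ! i) \<and>
          v ! i \<oplus>\<^bsub>Rs ! i\<^esub> u ! i = \<one>\<^bsub>Rs ! i\<^esub>)"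
      unfolding Bex_def by simp
    also have "\<dots> \<longleftrightarrow> (\<forall>i<length Rs. \<exists>y. y \<in> Units (Rs ! i) \<and> y \<oplus>\<^bsub>Rs ! i\<^esub> u ! i = \<one>\<^bsub>Rs ! i\<^esub>)"
      by (rule ex_carrier_iff) (auto intro: cl)
    finally show ?thesis
      unfolding P.exceptional_units_iff Units_iff using comp by auto
  next
    case False
    then show ?thesis
      using P.exceptional_units_subset comp cl carrier_iff[of u] by blast
  qed
qed

lemma exceptional_products_iff:
  "u \<in> exceptional_products P k \<longleftrightarrow>
    length u = length Rs \<and> (\<forall>i<length Rs. u ! i \<in> exceptional_products (Rs ! i) k)"
proof (induction k arbitrary: u)
  case 0
  have "u \<in> exceptional_products P 0 \<longleftrightarrow> u \<in> carrier P \<and> u = \<one>\<^bsub>P\<^esub>"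
    by (auto simp: P.exceptional_products_0)
  also have "\<dots> \<longleftrightarrow> u \<in> carrier P \<and> (\<forall>i<length Rs. u ! i = \<one>\<^bsub>Rs ! i\<^esub>)"
    using eq_iff[of u "\<one>\<^bsub>P\<^esub>"] by (auto simp: RDirProd_list_nth_one)
  also have "\<dots> \<longleftrightarrow> length u = length Rs \<and> (\<forall>i<length Rs. u ! i = \<one>\<^bsub>Rs ! i\<^esub>)"
  proof -
    have "\<one>\<^bsub>Rs ! i\<^esub> \<in> carrier (Rs ! i)" if "i < length Rs" for i
    proof -
      interpret Ri: cring "Rs ! i" by (rule cring_nth[OF that])
      show ?thesis by simp
    qed
    then show ?thesis by (auto simp: carrier_iff)
  qed
  finally show ?case
    using cring.exceptional_products_0[OF cring_nth] by auto
next
  case (Suc k)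
  have comp: "exceptional_products (Rs ! i) (Suc k) =
      exceptional_products (Rs ! i) k <#>\<^bsub>Rs ! i\<^esub> exceptional_units (Rs ! i)"
    and sub: "exceptional_products (Rs ! i) k \<subseteq> carrier (Rs ! i)"
      "exceptional_units (Rs ! i) \<subseteq> carrier (Rs ! i)"
    if "i < length Rs" for i
    using cring_nth[OF that]
    by (simp_all add: cring.exceptional_products_Suc cring.exceptional_products_subset
        cring.exceptional_units_subset)
  show ?case
  proof
    assume "u \<in> exceptional_products P (Suc k)"
    then obtain v w where v: "v \<in> exceptional_products P k" and w: "w \<in> exceptional_units P"
      and u: "u = v \<otimes>\<^bsub>P\<^esub> w"
      by (auto simp: P.exceptional_products_Suc set_mult_def)
    have c: "v \<in> carrier P" "w \<in> carrier P"
      using v w P.exceptional_products_subset P.exceptional_units_subset by blast+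
    then have "length u = length Rs"
      unfolding u using carrier_iff by blast
    moreover have "u ! i \<in> exceptional_products (Rs ! i) (Suc k)" if "i < length Rs" for i
      using v w that unfolding comp[OF that] Suc.IH exceptional_units_iff u
      by (auto simp: RDirProd_list_nth_mult_add[OF c that] set_mult_def)
    ultimately show "length u = length Rs \<and> (\<forall>i<length Rs. u ! i \<in> exceptional_products (Rs ! i) (Suc k))"
      by blast
  next
    assume u: "length u = length Rs \<and> (\<forall>i<length Rs. u ! i \<in> exceptional_products (Rs ! i) (Suc k))"
    \<comment> \<open>Both factors of each entry are chosen together as a pair; the two projections
      of the resulting list are then the factors of \<open>u\<close> in the product.\<close>
    then have "\<forall>i<length Rs. \<exists>z. fst z \<in> exceptional_products (Rs ! i) k \<and>
        snd z \<in> exceptional_units (Rs ! i) \<and> u ! i = fst z \<otimes>\<^bsub>Rs ! i\<^esub> snd z"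
      by (auto simp: comp set_mult_def)
    then obtain zs where zs: "length zs = length Rs"
      "\<forall>i<length Rs. fst (zs ! i) \<in> exceptional_products (Rs ! i) k \<and>
        snd (zs ! i) \<in> exceptional_units (Rs ! i) \<and> u ! i = fst (zs ! i) \<otimes>\<^bsub>Rs ! i\<^esub> snd (zs ! i)"
      unfolding ex_list_iff[symmetric] by blast
    have v: "map fst zs \<in> exceptional_products P k" and w: "map snd zs \<in> exceptional_units P"
      using zs by (auto simp: Suc.IH exceptional_units_iff)
    then have c: "map fst zs \<in> carrier P" "map snd zs \<in> carrier P"
      using P.exceptional_products_subset P.exceptional_units_subset by blast+
    have "u ! i = (map fst zs \<otimes>\<^bsub>P\<^esub> map snd zs) ! i" if "i < length Rs" for i
      using zs that by (simp add: RDirProd_list_nth_mult_add[OF c that])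
    moreover have "length (map fst zs \<otimes>\<^bsub>P\<^esub> map snd zs) = length Rs"
      using P.m_closed[OF c] carrier_iff by blast
    ultimately have "u = map fst zs \<otimes>\<^bsub>P\<^esub> map snd zs"
      using u by (simp add: list_eq_iff_nth_eq)
    with v w show "u \<in> exceptional_products P (Suc k)"
      by (auto simp: P.exceptional_products_Suc set_mult_def)
  qed
qed

lemma finite_nth_carrier:
  assumes "finite (carrier P)" "i < length Rs"
  shows "finite (carrier (Rs ! i))"
proof -
  \<comment> \<open>The projection to the factor is onto: place \<open>x\<close> in position
    \<open>i\<close> of the identity.\<close>
  have "x \<in> (\<lambda>u. u ! i) ` carrier P" if "x \<in> carrier (Rs ! i)" for x
  proof
    show "x = (\<one>\<^bsub>P\<^esub>[i := x]) ! i" "\<one>\<^bsub>P\<^esub>[i := x] \<in> carrier P"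
      using P.one_closed that assms(2) by (auto simp: carrier_iff nth_list_update)
  qed
  then show ?thesis
    using assms(1) by (meson finite_imageI finite_subset subsetI)
qed

end

section \<open>Finite local rings\<close>

text \<open>Finiteness of the carrier leaves only finitely many proper ideals above
  \<open>I\<close>, so one maximal under inclusion exists without Zorn's lemma.\<close>

lemma (in cring) ex_maximalideal_superset:
  assumes "finite (carrier R)" "ideal I R" "I \<noteq> carrier R"
  shows "\<exists>J. maximalideal J R \<and> I \<subseteq> J"
proof -
  let ?A = "{J. ideal J R \<and> I \<subseteq> J \<and> J \<noteq> carrier R}"
  have sub: "J \<subseteq> carrier R" if "ideal J R" for J
    using ideal.Icarr[OF that] by blast
  then have "finite ?A"
    using assms(1) by (intro finite_subset[of ?A "Pow (carrier R)"]) auto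
  moreover have "I \<in> ?A"
    using assms(2,3) by simp
  ultimately have "\<exists>J\<in>?A. \<forall>K\<in>?A. J \<subseteq> K \<longrightarrow> J = K"
    by (intro finite_has_maximal) auto
  then obtain J where J: "J \<in> ?A" and max: "\<forall>K\<in>?A. J \<subseteq> K \<longrightarrow> J = K"
    by (rule bexE)
  have "K = J \<or> K = carrier R" if "ideal K R" "J \<subseteq> K" for K
    using J max that by auto
  then have "maximalideal J R"
    using J by (intro maximalidealI) auto
  then show ?thesis
    using J by auto
qed

text \<open>With three elements there is only one besides \<open>\<zero>\<close> and
  \<open>\<one>\<close>, hence \<open>a = b\<close>. Its square is not \<open>\<zero>\<close> in a
  domain, and not \<open>a\<close> by cancellation, which leaves \<open>\<one>\<close>.\<close>

lemma (in domain) mult_order_3: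
  assumes "order R = 3" "a \<in> carrier R - {\<zero>, \<one>}" "b \<in> carrier R - {\<zero>, \<one>}"
  shows "a \<otimes> b = \<one>"
proof -
  have fin: "finite (carrier R)"
    using assms(1) by (simp add: order_def card_ge_0_finite)
  have "card {\<zero>, \<one>, a} = 3" "{\<zero>, \<one>, a} \<subseteq> carrier R"
    using assms(2) by auto
  then have eq: "carrier R = {\<zero>, \<one>, a}"
    using fin assms(1) by (metis card_subset_eq order_def)
  have "b = a"
    using assms(3) eq by auto
  moreover have "a \<otimes> a \<noteq> \<zero>"
    using assms(2) by (simp add: integral_iff)
  moreover have "a \<otimes> a \<noteq> a"
    using assms(2) m_lcancel[of a a \<one>] by auto
  moreover have "a \<otimes> a \<in> carrier R"
    using assms(2) by simp
  ultimately show ?thesis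
    unfolding eq by auto
qed

locale finite_local_ring = cring +
  fixes M
  assumes finite_carrier: "finite (carrier R)"
    and local: "local_ring R"
    and max: "maximalideal M R"
begin

abbreviation F where "F \<equiv> R Quot M"
abbreviation h where "h \<equiv> \<lambda>x. M +> x"

sublocale M: maximalideal M R by (rule max)
sublocale F: field F by (rule M.quotient_is_field) (rule is_cring)

lemma h_hom: "h \<in> ring_hom R F"
  by (rule M.rcos_ring_hom)

lemma h_mult: "x \<in> carrier R \<Longrightarrow> y \<in> carrier R \<Longrightarrow> h (x \<otimes> y) = h x \<otimes>\<^bsub>F\<^esub> h y"
  using ring_hom_mult[OF h_hom] .

lemma h_one: "h \<one> = \<one>\<^bsub>F\<^esub>"
  using ring_hom_one[OF h_hom] .

lemma h_closed: "x \<in> carrier R \<Longrightarrow> h x \<in> carrier F"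
  using ring_hom_closed[OF h_hom] .

lemma h_surj: "y \<in> carrier F \<Longrightarrow> \<exists>x\<in>carrier R. y = h x"
  by (auto simp: FactRing_def A_RCOSETS_def')

lemma h_eq_zero_iff: "x \<in> carrier R \<Longrightarrow> h x = \<zero>\<^bsub>F\<^esub> \<longleftrightarrow> x \<in> M"
  using M.rcos_const_imp_mem[of x] a_rcos_zero[OF M.is_ideal, of x] by (auto simp: FactRing_def)

text \<open>Translates the coset of the theorem into a condition on residues: having residue one
  means differing from \<open>\<one>\<close> by an element of \<open>M\<close>.\<close>

lemma one_plus_M_iff: "x \<in> \<one> <+ M \<longleftrightarrow> x \<in> carrier R \<and> h x = \<one>\<^bsub>F\<^esub>"
proof
  assume "x \<in> \<one> <+ M"
  then obtain m where m: "m \<in> M" "x = \<one> \<oplus> m"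
    by (auto simp: a_l_coset_def')
  then have c: "m \<in> carrier R"
    using M.Icarr by blast
  have "h x = h \<one> \<oplus>\<^bsub>F\<^esub> h m"
    unfolding m(2) using ring_hom_add[OF h_hom one_closed c] .
  also have "\<dots> = \<one>\<^bsub>F\<^esub>"
    using m c by (simp add: h_one h_eq_zero_iff[THEN iffD2])
  finally show "x \<in> carrier R \<and> h x = \<one>\<^bsub>F\<^esub>"
    using m c by simp
next
  assume x: "x \<in> carrier R \<and> h x = \<one>\<^bsub>F\<^esub>"
  then have "x \<ominus> \<one> \<in> M"
    using quotient_eq_iff_same_a_r_cos[OF M.is_ideal, of x \<one>] by (simp add: h_one)
  moreover have "x = \<one> \<oplus> (x \<ominus> \<one>)"
    using x by (simp add: a_minus_def a_lcomm r_neg)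
  ultimately show "x \<in> \<one> <+ M"
    by (auto simp: a_l_coset_def')
qed

text \<open>A unit has an invertible, hence nonzero, residue. Conversely, if the principal ideal of
  \<open>u\<close> were proper, a maximal ideal would contain it; by locality that ideal is
  \<open>M\<close>, so the residue of \<open>u\<close> would vanish.\<close>

lemma Units_iff: "u \<in> Units R \<longleftrightarrow> u \<in> carrier R \<and> h u \<noteq> \<zero>\<^bsub>F\<^esub>"
proof
  assume u: "u \<in> Units R"
  then have c: "u \<in> carrier R" "inv u \<in> carrier R"
    by auto
  have "h (inv u) \<otimes>\<^bsub>F\<^esub> h u = \<one>\<^bsub>F\<^esub>"
    using u c by (simp add: h_mult[symmetric] h_one)
  then show "u \<in> carrier R \<and> h u \<noteq> \<zero>\<^bsub>F\<^esub>"
    using c h_closed F.r_null F.one_not_zero by metis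
next
  assume u: "u \<in> carrier R \<and> h u \<noteq> \<zero>\<^bsub>F\<^esub>"
  have I: "ideal (PIdl u) R"
    using u by (intro cgenideal_ideal) simp
  show "u \<in> Units R"
  proof (cases "PIdl u = carrier R")
    case True
    then have "\<one> \<in> PIdl u"
      by simp
    then obtain v where v: "v \<in> carrier R" "\<one> = v \<otimes> u"
      unfolding cgenideal_def by blast
    moreover have "u \<otimes> v = v \<otimes> u"
      using u v(1) by (simp add: m_comm)
    ultimately show ?thesis
      using u unfolding Units_def by auto
  next
    case False
    then obtain J where J: "maximalideal J R" "PIdl u \<subseteq> J"
      using ex_maximalideal_superset[OF finite_carrier I] by blast
    then have "J = M"
      using local max by (auto simp: local_ring_def)
    then have "u \<in> M"
      using J(2) cgenideal_self[of u] u by blast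
    then show ?thesis
      using u h_eq_zero_iff by blast
  qed
qed

text \<open>By the residue test for units, \<open>\<one> \<ominus> u\<close> fails to be a unit
  exactly when it lies in \<open>M\<close>, that is, when \<open>u\<close> and \<open>\<one>\<close>
  have the same residue.\<close>

lemma exceptional_units_eq: "exceptional_units R = Units R - (\<one> <+ M)"
proof -
  have "\<one> \<ominus> u \<in> Units R \<longleftrightarrow> h u \<noteq> \<one>\<^bsub>F\<^esub>" if "u \<in> carrier R" for u
  proof -
    have "\<one> \<ominus> u \<in> Units R \<longleftrightarrow> \<one> \<ominus> u \<notin> M"
      using that by (simp add: Units_iff h_eq_zero_iff)
    also have "\<dots> \<longleftrightarrow> h \<one> \<noteq> h u"
      using quotient_eq_iff_same_a_r_cos[OF M.is_ideal, of \<one> u] that by simp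
    finally show ?thesis
      by (auto simp: h_one)
  qed
  then show ?thesis
    by (auto simp: exceptional_units_def one_plus_M_iff Units_closed)
qed

lemma exceptional_units_iff:
  "u \<in> exceptional_units R \<longleftrightarrow> u \<in> carrier R \<and> h u \<noteq> \<zero>\<^bsub>F\<^esub> \<and> h u \<noteq> \<one>\<^bsub>F\<^esub>"
  unfolding exceptional_units_eq by (auto simp: Units_iff one_plus_M_iff)

section \<open>Factorizations found by counting residue classes\<close>

lemma ex_avoiding:
  assumes "finite A" "card A < order F"
  shows "\<exists>x\<in>carrier R. h x \<notin> A"
proof -
  have "\<not> carrier F \<subseteq> A"
    using assms card_mono[of A "carrier F"] by (auto simp: order_def)
  then show ?thesis
    using h_surj by blast
qed

lemma exceptional_units_nonempty:
  assumes "order F > 2"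
  shows "exceptional_units R \<noteq> {}"
proof -
  have "card {\<zero>\<^bsub>F\<^esub>, \<one>\<^bsub>F\<^esub>} < order F"
    using assms by (metis F.zero_not_one card_2_iff)
  then obtain x where "x \<in> carrier R" "h x \<notin> {\<zero>\<^bsub>F\<^esub>, \<one>\<^bsub>F\<^esub>}"
    using ex_avoiding[of "{\<zero>\<^bsub>F\<^esub>, \<one>\<^bsub>F\<^esub>}"] by auto
  then show ?thesis
    using exceptional_units_iff by blast
qed

text \<open>If \<open>x\<close> avoids the residues of zero, one and \<open>u\<close>, then
  \<open>x\<close> is exceptional, and so is its cofactor, since a cofactor of residue one would
  give \<open>h u = h x\<close>. Bounding the cardinality of the set of forbidden residues covers
  both \<open>order F > 3\<close> and the case \<open>order F = 3\<close> with \<open>h u\<close>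
  equal to one, where only two residues are forbidden.\<close>

lemma mem_exceptional_products_2:
  assumes "u \<in> Units R" "card {\<zero>\<^bsub>F\<^esub>, \<one>\<^bsub>F\<^esub>, h u} < order F"
  shows "u \<in> exceptional_products R 2"
proof -
  obtain x where x: "x \<in> carrier R" "h x \<notin> {\<zero>\<^bsub>F\<^esub>, \<one>\<^bsub>F\<^esub>, h u}"
    using ex_avoiding[OF _ assms(2)] by auto
  then have xE: "x \<in> exceptional_units R" and xU: "x \<in> Units R"
    by (auto simp: exceptional_units_iff Units_iff)
  let ?y = "inv x \<otimes> u"
  have yU: "?y \<in> Units R"
    using xU assms(1) by simp
  have uc: "u \<in> carrier R" and xy: "x \<otimes> ?y = u"
    using xU assms(1) by (auto simp: m_assoc[symmetric] Units_closed)
  have "h u = h x \<otimes>\<^bsub>F\<^esub> h ?y"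
    using h_mult[of x ?y] x(1) yU xy by (simp add: Units_closed)
  then have "h ?y \<noteq> \<one>\<^bsub>F\<^esub>"
    using x h_closed[OF x(1)] by auto
  then have "?y \<in> exceptional_units R"
    using yU by (simp add: exceptional_units_iff Units_iff)
  with xE xy show ?thesis
    unfolding exceptional_products_2 set_mult_def by force
qed

lemma exceptional_products_subset_Units: "exceptional_products R k \<subseteq> Units R"
proof (induction k)
  case (Suc k)
  then show ?case
    by (auto simp: exceptional_products_Suc set_mult_def exceptional_units_eq)
qed (simp add: exceptional_products_0)

lemma exceptional_products_order_gt_3:
  assumes "order F > 3" "k \<ge> 2"
  shows "exceptional_products R k = Units R"
  using assms(2)
proof (induction k rule: dec_induct)
  case base
  have "u \<in> exceptional_products R 2" if "u \<in> Units R" for u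
  proof (rule mem_exceptional_products_2[OF that])
    have "card {\<zero>\<^bsub>F\<^esub>, \<one>\<^bsub>F\<^esub>, h u} \<le> 3"
      by (simp add: card_insert_if)
    then show "card {\<zero>\<^bsub>F\<^esub>, \<one>\<^bsub>F\<^esub>, h u} < order F"
      using assms(1) by simp
  qed
  then show ?case
    using exceptional_products_subset_Units by blast
next
  case (step k)
  \<comment> \<open>Dividing by one fixed exceptional unit keeps a unit a unit, so appending a
    factor \<open>e\<close> to shorter products still reaches every unit.\<close>
  obtain e where e: "e \<in> exceptional_units R"
    using exceptional_units_nonempty assms(1) by fastforce
  then have eU: "e \<in> Units R"
    by (simp add: exceptional_units_eq)
  have "u \<in> Units R <#> exceptional_units R" if "u \<in> Units R" for u
  proof -
    have "u = (u \<otimes> inv e) \<otimes> e"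
      using that eU by (simp add: m_assoc Units_closed)
    moreover have "u \<otimes> inv e \<in> Units R"
      using that eU by simp
    ultimately show ?thesis
      using e unfolding set_mult_def by blast
  qed
  then show ?case
    using exceptional_products_subset_Units[of "Suc k"]
    by (auto simp: exceptional_products_Suc step.IH)
qed

text \<open>Each exceptional factor has the one residue other than zero and one, so it switches
  between the two nonzero residues. The induction starts at \<open>k = 1\<close>: the empty product
  yields only \<open>\<one>\<close>, which need not fill the coset
  \<open>\<one> <+ M\<close>.\<close>

lemma exceptional_products_order_3:
  assumes "order F = 3" "k \<ge> 1"
  shows "exceptional_products R k =
    (if even k then \<one> <+ M else Units R - (\<one> <+ M))"
  using assms(2)
proof (induction k rule: dec_induct)
  case base
  then show ?case
    using exceptional_products_1 exceptional_units_eq by simp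
next
  case (step k)
  show ?case
  proof (cases "even k")
    case True
    have "(\<one> <+ M) <#> exceptional_units R = exceptional_units R"
    proof (intro subset_antisym subsetI)
      fix p
      assume "p \<in> (\<one> <+ M) <#> exceptional_units R"
      then show "p \<in> exceptional_units R"
        by (auto simp: set_mult_def one_plus_M_iff exceptional_units_iff h_mult h_closed)
    next
      fix p
      assume p: "p \<in> exceptional_units R"
      then have "p = \<one> \<otimes> p" "\<one> \<in> \<one> <+ M"
        by (auto simp: exceptional_units_iff one_plus_M_iff h_one)
      with p show "p \<in> (\<one> <+ M) <#> exceptional_units R"
        unfolding set_mult_def by blast
    qed
    with True step.IH show ?thesis
      by (simp add: exceptional_products_Suc exceptional_units_eq)
  next
    case False
    \<comment> \<open>By the induction hypothesis the products for odd \<open>k\<close> are the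
      exceptional units themselves, so the next set consists of twofold products. An element of
      residue one is such a product because only two of the three residues are forbidden.\<close>
    have "exceptional_units R <#> exceptional_units R = \<one> <+ M"
    proof (intro subset_antisym subsetI)
      fix p
      assume "p \<in> exceptional_units R <#> exceptional_units R"
      then show "p \<in> \<one> <+ M"
        using F.mult_order_3[OF assms(1)]
        by (auto simp: set_mult_def one_plus_M_iff exceptional_units_iff h_mult h_closed)
    next
      fix p
      assume "p \<in> \<one> <+ M"
      then have p: "p \<in> carrier R" "h p = \<one>\<^bsub>F\<^esub>"
        by (auto simp: one_plus_M_iff)
      have "card {\<zero>\<^bsub>F\<^esub>, \<one>\<^bsub>F\<^esub>, h p} \<le> 2"
        by (simp add: p(2) card_insert_if)
      then show "p \<in> exceptional_units R <#> exceptional_units R"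
        unfolding exceptional_products_2[symmetric] using p assms(1)
        by (intro mem_exceptional_products_2) (auto simp: Units_iff)
    qed
    with False step.IH show ?thesis
      by (simp add: exceptional_products_Suc exceptional_units_eq)
  qed
qed

end

section \<open>From the local factors back to the whole ring\<close>

theorem theorem1p9:
  fixes R :: "('r, 'p) ring_scheme"
    and Rs :: "('a, 'm) ring_scheme list"
    and M :: "nat \<Rightarrow> 'a set"
    and q :: "nat \<Rightarrow> nat"
    and n :: nat
    and \<phi> :: "'r \<Rightarrow> 'a list"
  assumes "cring R" and "finite (carrier R)"
    and "n = length Rs"
    and "\<And>i. i < n \<Longrightarrow> local_ring (Rs ! i)"
    and "\<And>i. i < n \<Longrightarrow> maximalideal (M i) (Rs ! i)"
    and "\<And>i. i < n \<Longrightarrow> q i = order ((Rs ! i) Quot (M i))"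
    and "\<phi> \<in> ring_iso R (RDirProd_list Rs)"
  shows "((\<forall>i<n. q i > 3) \<longrightarrow>
           exceptional_units R <#>\<^bsub>R\<^esub> exceptional_units R = Units R) \<and>
         (\<forall>s. 1 \<le> s \<and> s \<le> n \<and> (\<forall>i<s. q i = 3) \<and> (\<forall>j<n. s \<le> j \<longrightarrow> q j > 3) \<longrightarrow>
           (\<forall>k\<ge>2. \<phi> ` exceptional_products R k =
              {u. length u = n \<and>
                  (\<forall>j<n. s \<le> j \<longrightarrow> u ! j \<in> Units (Rs ! j)) \<and>
                  (\<forall>i<s. u ! i \<in> (if even k
                     then \<one>\<^bsub>Rs ! i\<^esub> <+\<^bsub>Rs ! i\<^esub> M i
                     else Units (Rs ! i) - (\<one>\<^bsub>Rs ! i\<^esub> <+\<^bsub>Rs ! i\<^esub> M i)))}) \<and>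
           ((\<forall>u\<in>Units R. \<exists>k\<ge>1. u \<in> exceptional_products R k) \<longleftrightarrow> s = 1))"
proof -
  interpret R: cring R by fact
  interpret L: cring_list Rs
    using assms(3,4) by (intro cring_list.intro) (simp add: local_ring_def)
  note \<phi> = ring_iso_memE[OF assms(7)]
  have inj: "inj_on \<phi> (carrier R)" and surj: "\<phi> ` carrier R = carrier L.P"
    using \<phi>(5) by (auto simp: bij_betw_def)
  have finP: "finite (carrier L.P)"
    unfolding surj[symmetric] using assms(2) by simp
  have loc: "finite_local_ring (Rs ! i) (M i)" if "i < n" for i
    using that assms(3) assms(4,5)[OF that] L.cring_nth L.finite_nth_carrier[OF finP]
    by (simp add: finite_local_ring_def finite_local_ring_axioms_def)
  have image: "\<phi> ` exceptional_products R k =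
      {u. length u = n \<and> (\<forall>i<n. u ! i \<in> exceptional_products (Rs ! i) k)}" for k
    using ring_iso_image_exceptional_products[OF assms(1) L.cring_P assms(7), of k]
      L.exceptional_products_iff[of _ k] by (auto simp: assms(3))
  have gt3: "exceptional_products (Rs ! i) k = Units (Rs ! i)"
    if "i < n" "q i > 3" "k \<ge> 2" for i k
    using finite_local_ring.exceptional_products_order_gt_3[OF loc[OF that(1)]] that assms(6)
    by simp
  have eq3: "exceptional_products (Rs ! i) k = (if even k then \<one>\<^bsub>Rs ! i\<^esub> <+\<^bsub>Rs ! i\<^esub> M i
      else Units (Rs ! i) - (\<one>\<^bsub>Rs ! i\<^esub> <+\<^bsub>Rs ! i\<^esub> M i))"
    if "i < n" "q i = 3" "k \<ge> 1" for i k
    using finite_local_ring.exceptional_products_order_3[OF loc[OF that(1)]] that assms(6)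
    by simp
  have units: "u \<in> Units R \<longleftrightarrow> (\<forall>i<n. \<phi> u ! i \<in> Units (Rs ! i))" if "u \<in> carrier R" for u
    using ring_iso_Units[OF assms(1) L.cring_P assms(7) that] \<phi>(1)[OF that]
    by (simp add: L.Units_iff L.carrier_iff assms(3))
  \<comment> \<open>Injectivity of \<open>\<phi>\<close> upgrades the description of the image to a
    membership test in \<open>R\<close> itself.\<close>
  have mem: "u \<in> exceptional_products R k \<longleftrightarrow> (\<forall>i<n. \<phi> u ! i \<in> exceptional_products (Rs ! i) k)"
    if "u \<in> carrier R" for u k
    using inj_on_image_mem_iff[OF inj that R.exceptional_products_subset, of k] \<phi>(1)[OF that]
    by (simp add: image L.carrier_iff assms(3))
  show ?thesis
  proof (intro conjI impI allI)
    assume "\<forall>i<n. 3 < q i"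
    then have "u \<in> exceptional_products R 2 \<longleftrightarrow> u \<in> Units R" if "u \<in> carrier R" for u
      using that by (simp add: mem units gt3)
    then show "exceptional_units R <#>\<^bsub>R\<^esub> exceptional_units R = Units R"
      unfolding R.exceptional_products_2[symmetric]
      using R.exceptional_products_subset R.Units_closed by blast
  next
    fix s k :: nat
    assume s: "1 \<le> s \<and> s \<le> n \<and> (\<forall>i<s. q i = 3) \<and> (\<forall>j<n. s \<le> j \<longrightarrow> 3 < q j)" and k: "2 \<le> k"
    \<comment> \<open>The indices below \<open>n\<close> split at \<open>s\<close>; the bound
      \<open>s \<le> n\<close> keeps the first block within range.\<close>
    have "(\<forall>i<n. u ! i \<in> exceptional_products (Rs ! i) k) \<longleftrightarrow>
        (\<forall>j<n. s \<le> j \<longrightarrow> u ! j \<in> exceptional_products (Rs ! j) k) \<and>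
        (\<forall>i<s. u ! i \<in> exceptional_products (Rs ! i) k)" for u
      using s by (meson leI less_le_trans)
    moreover have "exceptional_products (Rs ! j) k = Units (Rs ! j)" if "j < n" "s \<le> j" for j
      using gt3 that s k by simp
    moreover have "exceptional_products (Rs ! i) k = (if even k
        then \<one>\<^bsub>Rs ! i\<^esub> <+\<^bsub>Rs ! i\<^esub> M i
        else Units (Rs ! i) - (\<one>\<^bsub>Rs ! i\<^esub> <+\<^bsub>Rs ! i\<^esub> M i))" if "i < s" for i
      using eq3[of i k] that s k by simp
    ultimately show "\<phi> ` exceptional_products R k =
              {u. length u = n \<and>
                  (\<forall>j<n. s \<le> j \<longrightarrow> u ! j \<in> Units (Rs ! j)) \<and>
                  (\<forall>i<s. u ! i \<in> (if even k
                     then \<one>\<^bsub>Rs ! i\<^esub> <+\<^bsub>Rs ! i\<^esub> M i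
                     else Units (Rs ! i) - (\<one>\<^bsub>Rs ! i\<^esub> <+\<^bsub>Rs ! i\<^esub> M i)))}"
      unfolding image by (intro Collect_cong) simp
  next
    fix s :: nat
    assume s: "1 \<le> s \<and> s \<le> n \<and> (\<forall>i<s. q i = 3) \<and> (\<forall>j<n. s \<le> j \<longrightarrow> 3 < q j)"
    show "(\<forall>u\<in>Units R. \<exists>k\<ge>1. u \<in> exceptional_products R k) \<longleftrightarrow> s = 1"
    proof
      assume "s = 1"
      show "\<forall>u\<in>Units R. \<exists>k\<ge>1. u \<in> exceptional_products R k"
      proof
        fix u
        assume u: "u \<in> Units R"
        then have uc: "u \<in> carrier R"
          by blast
        have unit: "\<phi> u ! i \<in> Units (Rs ! i)" if "i < n" for i
          using units[OF uc] u that by blast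
        \<comment> \<open>With \<open>s = 1\<close> only factor 0 has a residue field of order
          three, so its component alone dictates the parity. Both values are at least 2, so the
          remaining factors admit all units.\<close>
        define k :: nat where "k = (if \<phi> u ! 0 \<in> \<one>\<^bsub>Rs ! 0\<^esub> <+\<^bsub>Rs ! 0\<^esub> M 0 then 2 else 3)"
        have k: "k \<ge> 2"
          by (simp add: k_def)
        have "\<phi> u ! i \<in> exceptional_products (Rs ! i) k" if "i < n" for i
        proof (cases "i = 0")
          case True
          then show ?thesis
            using eq3[of 0 k] k unit[of 0] that s \<open>s = 1\<close> by (auto simp: k_def)
        next
          case False
          then show ?thesis
            using gt3[of i k] k unit[OF that] that s \<open>s = 1\<close> by simp
        qed
        then have "u \<in> exceptional_products R k"
          using mem[OF uc] by blast
        with k show "\<exists>k\<ge>1. u \<in> exceptional_products R k"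
          by (intro exI[of _ k]) simp
      qed
    next
      assume all: "\<forall>u\<in>Units R. \<exists>k\<ge>1. u \<in> exceptional_products R k"
      show "s = 1"
      proof (rule ccontr)
        assume "s \<noteq> 1"
        with s have s2: "0 < n" "1 < n" "q 0 = 3" "q 1 = 3"
          by auto
        interpret R0: finite_local_ring "Rs ! 0" "M 0" by (rule loc[OF s2(1)])
        interpret R1: finite_local_ring "Rs ! 1" "M 1" by (rule loc[OF s2(2)])
        obtain e where e: "e \<in> exceptional_units (Rs ! 1)"
          using R1.exceptional_units_nonempty s2(4) assms(6)[OF s2(2)] by fastforce
        \<comment> \<open>A unit with conflicting demands: residue one in factor 0 forces an even
          number of factors, while the exceptional entry in factor 1 forces an odd number.\<close>
        let ?v = "\<one>\<^bsub>L.P\<^esub>[1 := e]"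
        have "e \<in> Units (Rs ! 1)"
          using e unfolding R1.exceptional_units_eq by blast
        then have "?v ! i \<in> Units (Rs ! i)" if "i < length Rs" for i
          using that L.P.Units_one_closed unfolding L.Units_iff
          by (cases "i = 1") simp_all
        then have "?v \<in> Units L.P"
          using L.P.Units_one_closed unfolding L.Units_iff by simp
        then have "?v \<in> carrier L.P"
          by blast
        then obtain u where u: "u \<in> carrier R" "\<phi> u = ?v"
          unfolding surj[symmetric] by force
        then have "u \<in> Units R"
          using ring_iso_Units[OF assms(1) L.cring_P assms(7) u(1)] \<open>?v \<in> Units L.P\<close> by simp
        then obtain k where k: "k \<ge> 1" "u \<in> exceptional_products R k"
          using all by blast
        have len: "length \<one>\<^bsub>L.P\<^esub> = n"
          using L.P.one_closed unfolding L.carrier_iff by (simp add: assms(3))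
        have v: "?v ! 0 = \<one>\<^bsub>Rs ! 0\<^esub>" "?v ! 1 = e"
          using s2 len RDirProd_list_nth_one[of 0 Rs] by (simp_all add: assms(3))
        have mem01: "\<one>\<^bsub>Rs ! 0\<^esub> \<in> exceptional_products (Rs ! 0) k" "e \<in> exceptional_products (Rs ! 1) k"
          using k(2) s2(1,2) v unfolding mem[OF u(1)] u(2) by metis+
        have "\<one>\<^bsub>Rs ! 0\<^esub> \<in> \<one>\<^bsub>Rs ! 0\<^esub> <+\<^bsub>Rs ! 0\<^esub> M 0"
          by (simp add: R0.one_plus_M_iff R0.h_one)
        then have "even k"
          using mem01(1) eq3[OF s2(1,3) k(1)] by (auto split: if_splits)
        moreover have "odd k"
          using mem01(2) eq3[OF s2(2,4) k(1)] e
          unfolding R1.exceptional_units_eq by (auto split: if_splits)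
        ultimately show False
          by blast
      qed
    qed
  qed
qed

end
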